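(* Let $R$ be a p.q.-Baer $*$-ring and let $a,b\in R$ have a common upper bound with respect to Conrad's partial order $\leq$. Then: (1) $aC(b)=bC(a)$; (2) $a^*rb=C(a)b^*rb=C(b)a^*ra$ for all $r\in R$; hence $a^*b$ is self-adjoint; (3) $arb^*=C(a)brb^*=C(b)ara^*$ for all $r\in R$; hence $ab^*$ is self-adjoint; (4) $a\wedge b$ exists and $a\wedge b=aC(b)=bC(a)$; (5) $a\vee b$ exists and $a\vee b=a+b-a\wedge b$.
   Context: A $*$-ring is an (associative) ring $R$ with an involution $x\mapsto x^*$, i.e. an additive anti-automorphism with $(x^* )^*=x$. An element $x$ is self-adjoint if $x=x^*$; a projection is an element $e\in R$ with $e=e^2=e^*$. A $*$-ring $R$ is a p.q.-Baer $*$-ring if for every $a\in R$ there is a projection $e\in R$ with $r_R(aR)=eR$, where $r_R(B)=\{x\in R : bx=0 \text{ for every } b\in B\}$. (Such a ring automatically has an identity element and is semiprime.) Conrad's partial order on $R$: $a\leq b$ if and only if $arb=ara$ for all $r\in R$; this is a partial order on every p.q.-Baer $*$-ring. The central cover $C(x)$ of $x\in R$ is the smallest central projection $h$ with $hx=x$ (central projections being ordered by $e\leq f \iff e=ef$); it is known that every element of a p.q.-Baer $*$-ring has a central cover. $a\vee b$ and $a\wedge b$ denote $\sup\{a,b\}$ and $\inf\{a,b\}$ in $(R,\leq)$. *)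

theory Defs
  imports Main "HOL-Algebra.Lattice"
begin

(* The class ring of HOL does not assume an identity element. *)
class star_ring = ring +
  fixes star :: "'a \<Rightarrow> 'a"  ("_\<^sup>\<star>" [1000] 999)
  assumes star_add: "(x + y)\<^sup>\<star> = x\<^sup>\<star> + y\<^sup>\<star>"
    and star_mult: "(x * y)\<^sup>\<star> = y\<^sup>\<star> * x\<^sup>\<star>"
    and star_star: "(x\<^sup>\<star>)\<^sup>\<star> = x"
begin

definition self_adjoint :: "'a \<Rightarrow> bool" where
  "self_adjoint x \<longleftrightarrow> x = x\<^sup>\<star>"

definition projection :: "'a \<Rightarrow> bool" where
  "projection e \<longleftrightarrow> e = e * e \<and> e = e\<^sup>\<star>"

definition central_projection :: "'a \<Rightarrow> bool" where
  "central_projection h \<longleftrightarrow> projection h \<and> (\<forall>x. h * x = x * h)"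

definition right_annihilator :: "'a set \<Rightarrow> 'a set" where
  "right_annihilator B = {x. \<forall>b\<in>B. b * x = 0}"

(* Central projections are ordered by h \<le> f iff h = h * f. *)
definition is_central_cover :: "'a \<Rightarrow> 'a \<Rightarrow> bool" where
  "is_central_cover x h \<longleftrightarrow>
     central_projection h \<and> h * x = x \<and>
     (\<forall>f. central_projection f \<and> f * x = x \<longrightarrow> h = h * f)"

(* A central cover is unique whenever it exists; in a p.q.-Baer *-ring it always exists. *)
definition central_cover :: "'a \<Rightarrow> 'a" where
  "central_cover x = (THE h. is_central_cover x h)"

end

(* The images of UNIV below are the principal right ideals aR and eR. *)
class pq_baer_star_ring = star_ring +
  assumes right_annihilator_principal:
    "\<exists>e. projection e \<and> right_annihilator (range (\<lambda>r. a * r)) = range (\<lambda>r. e * r)"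

definition conrad_le :: "'a::ring \<Rightarrow> 'a \<Rightarrow> bool"  (infix "\<preceq>" 50) where
  "a \<preceq> b \<longleftrightarrow> (\<forall>r. a * r * b = a * r * a)"

definition conrad_order :: "'a::ring gorder" where
  "conrad_order = \<lparr>carrier = UNIV, eq = (=), le = (\<preceq>)\<rparr>"

end

theory Submission
  imports Defs
begin

text \<open>
  Every annihilator \<open>r(aR)\<close> is an ideal, so the projection generating it is central, and its
  complement is the central cover \<open>C(a)\<close>; thus \<open>aRx = 0\<close> iff \<open>C(a)x = 0\<close>. Consequently
  \<open>a \<le> u\<close> iff \<open>a = C(a)u\<close>, iff \<open>a = fu\<close> for some central projection \<open>f\<close>. With a common upper
  bound \<open>u\<close>, everything becomes a computation with the commuting idempotents \<open>C(a)\<close> and \<open>C(b)\<close>: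
  the infimum is \<open>C(a)C(b)u\<close> and the supremum is \<open>(C(a) + C(b) - C(a)C(b))u\<close>.
\<close>

lemma central_projection_commute: "central_projection h \<Longrightarrow> x * h = h * x"
  by (simp add: central_projection_def)

lemma central_projection_idem: "central_projection h \<Longrightarrow> h * h = h"
  unfolding central_projection_def projection_def by metis

lemma central_projection_idem_left: "central_projection h \<Longrightarrow> h * (h * x) = h * x"
  by (simp add: central_projection_idem flip: mult.assoc)

lemma central_projection_star: "central_projection h \<Longrightarrow> h\<^sup>\<star> = h"
  unfolding central_projection_def projection_def by metis

lemma central_projection_left_commute: "central_projection h \<Longrightarrow> x * (h * y) = h * (x * y)"
  by (simp add: central_projection_commute[of h x] flip: mult.assoc)

lemmas central_projection_simps =
  central_projection_idem central_projection_idem_left central_projection_star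

lemma star_diff: "(x - y)\<^sup>\<star> = x\<^sup>\<star> - (y::'a::star_ring)\<^sup>\<star>"
  by (simp add: eq_diff_eq flip: star_add)

lemma central_projection_mult:
  assumes "central_projection h" "central_projection f"
  shows "central_projection (h * f)"
proof -
  have comm: "f * h = h * f"
    using assms(1) by (rule central_projection_commute)
  have "h * f * x = x * (h * f)" for x
    by (metis assms central_projection_commute mult.assoc)
  moreover have "(h * f)\<^sup>\<star> = h * f"
    using assms by (simp add: star_mult central_projection_star comm)
  moreover have "h * f * (h * f) = h * f"
    using assms by (simp add: mult.assoc central_projection_simps
        central_projection_left_commute[of h f])
  ultimately show ?thesis
    unfolding central_projection_def projection_def by metis
qed

text \<open>This is the join in the Boolean algebra of central projections. Multiplying an upper
  bound of \<open>a\<close> and \<open>b\<close> by it will produce their supremum.\<close>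

lemma central_projection_join:
  assumes h: "central_projection h" and f: "central_projection f"
  shows "central_projection (h + f - h * f)"
proof -
  have hf: "central_projection (h * f)" using h f by (rule central_projection_mult)
  have "(h + f - h * f) * x = x * (h + f - h * f)" for x
    by (simp add: distrib_left distrib_right left_diff_distrib right_diff_distrib
        central_projection_commute[OF h, of x] central_projection_commute[OF f, of x]
        central_projection_commute[OF hf, of x])
  moreover have "(h + f - h * f)\<^sup>\<star> = h + f - h * f"
    using h f hf by (simp add: star_add star_diff central_projection_star)
  moreover have "(h + f - h * f) * (h + f - h * f) = h + f - h * f"
    using h f by (simp add: algebra_simps central_projection_simps
        central_projection_commute[OF h, of f] central_projection_left_commute[OF h, of f])
  ultimately show ?thesis
    unfolding central_projection_def projection_def by metis
qed

text \<open>Everything annihilates 0, so the projection attached to 0 generates the whole ring as a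
  right ideal and is a left identity; the involution makes it two-sided.\<close>

lemma ex_identity:
  obtains i :: "'a::pq_baer_star_ring"
  where "central_projection i" "\<And>x. i * x = x" "\<And>x. x * i = x"
proof -
  obtain i :: 'a where i: "projection i"
    and ann: "right_annihilator (range (\<lambda>r. 0 * r)) = range (\<lambda>r. i * r)"
    using right_annihilator_principal by blast
  have left: "i * x = x" for x
  proof -
    have "x \<in> right_annihilator (range (\<lambda>r. 0 * r))"
      by (simp add: right_annihilator_def)
    then obtain y where "x = i * y" using ann by auto
    then show ?thesis using i by (metis mult.assoc projection_def)
  qed
  have right: "x * i = x" for x
    using left[of "x\<^sup>\<star>"] i by (metis projection_def star_mult star_star)
  show thesis
    using that i left right by (simp add: central_projection_def)
qed

text \<open>The annihilator of \<open>aR\<close> is closed under left multiplication too, so it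
  contains \<open>s * e\<close> for every \<open>s\<close>. This gives
  \<open>e * s * e = s * e\<close>, and the involution turns it into
  \<open>e * s * e = e * s\<close>.\<close>

lemma annihilator_central_projection:
  fixes a :: "'a::pq_baer_star_ring"
  obtains e where "central_projection e" "\<And>x. (\<forall>r. a * r * x = 0) \<longleftrightarrow> e * x = x"
proof -
  obtain e where e: "projection e"
    and eq: "right_annihilator (range (\<lambda>r. a * r)) = range (\<lambda>r. e * r)"
    using right_annihilator_principal by blast
  have mem: "(\<forall>r. a * r * x = 0) \<longleftrightarrow> e * x = x" for x
  proof -
    have "(\<forall>r. a * r * x = 0) \<longleftrightarrow> x \<in> range (\<lambda>r. e * r)"
      unfolding eq[symmetric] by (simp add: right_annihilator_def)
    also have "\<dots> \<longleftrightarrow> e * x = x"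
    proof
      assume "x \<in> range (\<lambda>r. e * r)"
      then obtain y where "x = e * y" by blast
      then show "e * x = x" using e unfolding projection_def by (metis mult.assoc)
    qed (metis rangeI)
    finally show ?thesis .
  qed
  have ere: "e * (s * e) = s * e" for s
  proof -
    have "\<forall>r. a * r * e = 0" using mem[of e] e unfolding projection_def by metis
    then have "\<forall>r. a * r * (s * e) = 0" by (metis mult.assoc)
    then show ?thesis using mem by blast
  qed
  have "e * s = s * e" for s
  proof -
    have "e * s = (s\<^sup>\<star> * e)\<^sup>\<star>" using e by (metis projection_def star_mult star_star)
    also have "\<dots> = (e * (s\<^sup>\<star> * e))\<^sup>\<star>" by (simp add: ere)
    also have "\<dots> = e * s * e"
      using e by (metis projection_def star_mult star_star)
    finally show ?thesis by (metis ere mult.assoc)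
  qed
  then have "central_projection e" using e by (simp add: central_projection_def)
  then show ?thesis using that mem by blast
qed

lemma is_central_cover_unique:
  assumes "is_central_cover x h" "is_central_cover x k"
  shows "h = k"
  using assms unfolding is_central_cover_def by (metis central_projection_commute)

lemma
  fixes a :: "'a::pq_baer_star_ring"
  shows is_central_cover_central_cover: "is_central_cover a (central_cover a)"
    and annihilates_iff_central_cover: "(\<forall>r. a * r * x = 0) \<longleftrightarrow> central_cover a * x = 0"
proof -
  obtain i :: 'a where i: "central_projection i" "\<And>x. i * x = x" "\<And>x. x * i = x"
    using ex_identity by blast
  obtain e where e: "central_projection e" "\<And>x. (\<forall>r. a * r * x = 0) \<longleftrightarrow> e * x = x"
    using annihilator_central_projection[of a] by blast
  \<comment> \<open>The complement of the annihilating projection: \<open>h * x = x - e * x\<close>,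
    so \<open>h\<close> kills exactly the elements fixed by \<open>e\<close>.\<close>
  define h where "h = i - e"
  have h: "central_projection h"
    unfolding central_projection_def projection_def h_def using i e(1)
    by (auto simp: left_diff_distrib right_diff_distrib star_diff central_projection_simps)
       (metis central_projection_commute)
  have ann: "(\<forall>r. a * r * x = 0) \<longleftrightarrow> h * x = 0" for x
    unfolding e(2) h_def by (auto simp: left_diff_distrib i)
  \<comment> \<open>\<open>e\<close> fixes itself, hence lies in the annihilator of
    \<open>aR\<close>; the instance \<open>r = i\<close> gives \<open>a * e = 0\<close>.\<close>
  have "a * i * e = 0" using e by (metis central_projection_idem)
  then have "e * a = 0"
    using e(1) by (metis central_projection_commute i(3))
  then have "h * a = a"
    by (simp add: h_def left_diff_distrib i)
  \<comment> \<open>Minimality: if \<open>f\<close> fixes \<open>a\<close>, then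
    \<open>i - f\<close> annihilates \<open>aR\<close>, hence is killed by \<open>h\<close>.\<close>
  moreover have "h = h * f" if f: "central_projection f" "f * a = a" for f
  proof -
    have "a * r * (i - f) = 0" for r
    proof -
      have "a * r * f = a * r"
        using f by (metis central_projection_commute mult.assoc)
      then show ?thesis by (simp add: right_diff_distrib i)
    qed
    then have "h * (i - f) = 0" using ann by blast
    then show ?thesis by (simp add: right_diff_distrib i)
  qed
  ultimately have cover: "is_central_cover a h" using h by (simp add: is_central_cover_def)
  then have "central_cover a = h"
    unfolding central_cover_def by (blast intro: is_central_cover_unique)
  then show "is_central_cover a (central_cover a)"
    and "(\<forall>r. a * r * x = 0) \<longleftrightarrow> central_cover a * x = 0"
    using cover ann by auto
qed

lemma central_projection_central_cover: "central_projection (central_cover (a::'a::pq_baer_star_ring))"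
  using is_central_cover_central_cover[of a] by (simp add: is_central_cover_def)

lemma central_cover_mult: "central_cover a * a = (a::'a::pq_baer_star_ring)"
  using is_central_cover_central_cover[of a] by (simp add: is_central_cover_def)

text \<open>Conrad's relation says that \<open>b - a\<close> annihilates \<open>aR\<close>, a
  condition that the central cover of \<open>a\<close> detects.\<close>

lemma conrad_le_iff:
  fixes a b :: "'a::pq_baer_star_ring"
  shows "a \<preceq> b \<longleftrightarrow> central_cover a * b = a"
proof -
  have "a \<preceq> b \<longleftrightarrow> (\<forall>r. a * r * (b - a) = 0)"
    by (simp add: conrad_le_def right_diff_distrib)
  also have "\<dots> \<longleftrightarrow> central_cover a * (b - a) = 0"
    by (rule annihilates_iff_central_cover)
  finally show ?thesis
    by (simp add: right_diff_distrib central_cover_mult)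
qed

text \<open>Any central projection will do here, so an element of the form \<open>f * u\<close> is
  seen to lie below \<open>u\<close> without computing its central cover.\<close>

lemma conrad_le_mult_central_projection:
  assumes "central_projection f"
  shows "f * u \<preceq> u"
  unfolding conrad_le_def
  by (metis assms central_projection_idem_left central_projection_left_commute mult.assoc)

lemma partial_order_conrad: "partial_order (conrad_order :: 'a::pq_baer_star_ring gorder)"
proof -
  have antisym: "x = y" if "x \<preceq> y" "y \<preceq> x" for x y :: 'a
  proof -
    have x: "central_cover x * y = x" and y: "central_cover y * x = y"
      using that by (simp_all add: conrad_le_iff)
    \<comment> \<open>In \<open>x = C(x) y\<close> the factor C(y) moves past C(x) and is absorbed
      by \<open>y\<close>.\<close>
    have "central_cover y * x = x"
      by (metis x central_cover_mult central_projection_central_cover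
          central_projection_left_commute)
    then show ?thesis using y by simp
  qed
  have trans: "x \<preceq> z" if "x \<preceq> y" "y \<preceq> z" for x y z :: 'a
  proof -
    have "x = (central_cover x * central_cover y) * z"
      using that by (simp add: conrad_le_iff mult.assoc)
    then show ?thesis
      by (metis conrad_le_mult_central_projection central_projection_mult
          central_projection_central_cover)
  qed
  have refl: "x \<preceq> x" for x :: 'a
    by (simp add: conrad_le_def)
  show ?thesis
    by unfold_locales
      (simp_all add: conrad_order_def refl, blast intro: antisym, blast intro: trans)
qed

text \<open>The library's meet is a chosen greatest lower bound; antisymmetry makes the choice
  unique. The join is treated likewise.\<close>

lemma (in partial_order) meet_eq_glb: "is_glb L m {a, b} \<Longrightarrow> a \<sqinter> b = m"
  unfolding meet_def inf_def by (blast intro: greatest_unique)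

lemma (in partial_order) join_eq_lub: "is_lub L s {a, b} \<Longrightarrow> a \<squnion> b = s"
  unfolding join_def sup_def by (blast intro: least_unique)

text \<open>Both sides are C(a)C(b)u, since \<open>a = C(a) u\<close> and
  \<open>b = C(b) u\<close>.\<close>

lemma mult_central_cover:
  fixes a b u :: "'a::pq_baer_star_ring"
  assumes "a \<preceq> u" "b \<preceq> u"
  shows "a * central_cover b = central_cover a * b"
proof -
  have "a * central_cover b = central_cover a * (u * central_cover b)"
    using assms(1) by (simp add: conrad_le_iff flip: mult.assoc)
  also have "u * central_cover b = b"
    using assms(2) by (simp add: conrad_le_iff
        central_projection_commute[OF central_projection_central_cover])
  finally show ?thesis .
qed

lemma is_glb_conrad:
  fixes a b u :: "'a::pq_baer_star_ring"
  assumes "a \<preceq> u" "b \<preceq> u"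
  shows "is_glb conrad_order (a * central_cover b) {a, b}"
proof -
  let ?A = "central_cover a" and ?B = "central_cover b"
  have cp: "central_projection ?A" "central_projection ?B"
    by (rule central_projection_central_cover)+
  have m: "a * ?B = ?B * a" "a * ?B = ?A * b"
    by (rule central_projection_commute[OF cp(2)], rule mult_central_cover[OF assms])
  have "x \<preceq> a * ?B" if "x \<preceq> a" "x \<preceq> b" for x
  proof -
    have x: "central_cover x * a = x" "central_cover x * b = x"
      using that by (simp_all add: conrad_le_iff)
    \<comment> \<open>C(x) carries both \<open>a\<close> and \<open>b\<close> to \<open>x\<close>.
      The first equation moves it past C(b) to reach \<open>a\<close>; then
      \<open>x = C(x) b\<close> shows that C(b) fixes \<open>x\<close>.\<close>
    have "central_cover x * (?B * a) = ?B * x"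
      using x cp by (metis central_projection_left_commute)
    also have "\<dots> = x"
      using x cp by (metis central_cover_mult central_projection_left_commute)
    finally show ?thesis by (simp add: conrad_le_iff m(1))
  qed
  \<comment> \<open>The form \<open>?B * a\<close> gives the bound by \<open>a\<close>, the form
    \<open>?A * b\<close> the bound by \<open>b\<close>.\<close>
  moreover have "a * ?B \<preceq> a" "a * ?B \<preceq> b"
    using m cp conrad_le_mult_central_projection by metis+
  ultimately show ?thesis
    by (auto simp: greatest_def Lower_def conrad_order_def)
qed

lemma is_lub_conrad:
  fixes a b u :: "'a::pq_baer_star_ring"
  assumes "a \<preceq> u" "b \<preceq> u"
  shows "is_lub conrad_order (a + b - a * central_cover b) {a, b}"
proof -
  let ?A = "central_cover a" and ?B = "central_cover b"
  let ?s = "a + b - a * ?B"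
  have cp: "central_projection ?A" "central_projection ?B"
    by (rule central_projection_central_cover)+
  have m: "a * ?B = ?B * a" "a * ?B = ?A * b"
    by (rule central_projection_commute[OF cp(2)], rule mult_central_cover[OF assms])
  \<comment> \<open>With \<open>a * ?B\<close> written as \<open>?A * b\<close>, the last two terms
    of \<open>?A * ?s\<close> cancel. By \<open>conrad_le_iff\<close> this means that
    \<open>a\<close> lies below \<open>?s\<close>; the other form of \<open>a * ?B\<close> serves
    for \<open>b\<close>.\<close>
  have "?A * ?s = a"
    using cp by (simp add: algebra_simps m(2) central_cover_mult central_projection_idem_left)
  moreover have "?B * ?s = b"
    using cp by (simp add: algebra_simps m(1) central_cover_mult central_projection_idem_left)
  moreover have "?s \<preceq> v" if "a \<preceq> v" "b \<preceq> v" for v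
  proof -
    have v: "?A * v = a" "?B * v = b"
      using that by (simp_all add: conrad_le_iff)
    have "central_projection (?A + ?B - ?A * ?B)"
      using cp by (rule central_projection_join)
    \<comment> \<open>The upper bound \<open>v\<close> now plays the role of \<open>u\<close>, and
      the product does not depend on it.\<close>
    moreover have "(?A + ?B - ?A * ?B) * v = ?s"
      by (simp add: algebra_simps v m(2)[symmetric])
    ultimately show ?thesis
      by (metis conrad_le_mult_central_projection)
  qed
  ultimately show ?thesis
    by (auto simp: least_def Upper_def conrad_order_def conrad_le_iff)
qed

theorem theorem3p5:
  fixes a b :: "'a::pq_baer_star_ring"
  assumes "\<exists>u. a \<preceq> u \<and> b \<preceq> u"
  shows
    "a * central_cover b = b * central_cover a \<and>
     ((\<forall>r. a\<^sup>\<star> * r * b = central_cover a * b\<^sup>\<star> * r * b \<and>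
           central_cover a * b\<^sup>\<star> * r * b = central_cover b * a\<^sup>\<star> * r * a) \<and>
      self_adjoint (a\<^sup>\<star> * b)) \<and>
     ((\<forall>r. a * r * b\<^sup>\<star> = central_cover a * b * r * b\<^sup>\<star> \<and>
           central_cover a * b * r * b\<^sup>\<star> = central_cover b * a * r * a\<^sup>\<star>) \<and>
      self_adjoint (a * b\<^sup>\<star>)) \<and>
     ((\<exists>m. is_glb conrad_order m {a, b}) \<and>
      a \<sqinter>\<^bsub>conrad_order\<^esub> b = a * central_cover b \<and>
      a \<sqinter>\<^bsub>conrad_order\<^esub> b = b * central_cover a) \<and>
     ((\<exists>s. is_lub conrad_order s {a, b}) \<and>
      a \<squnion>\<^bsub>conrad_order\<^esub> b = a + b - (a \<sqinter>\<^bsub>conrad_order\<^esub> b))"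
proof -
  obtain u where "a \<preceq> u" "b \<preceq> u" using assms by blast
  \<comment> \<open>Opaque names: with \<open>central_cover a\<close> in place of \<open>A\<close>,
    rewriting by \<open>a = A * u\<close> would not terminate.\<close>
  define A B where "A = central_cover a" and "B = central_cover b"
  have cp: "central_projection A" "central_projection B"
    by (simp_all add: A_def B_def central_projection_central_cover)
  have a: "a = A * u" and b: "b = B * u"
    using \<open>a \<preceq> u\<close> \<open>b \<preceq> u\<close> by (simp_all add: A_def B_def conrad_le_iff)
  \<comment> \<open>Only selected instances are used, since the general rules for \<open>A\<close>
    and \<open>B\<close> would swap them forever. The chosen ones bring \<open>A\<close> to the
    front, then \<open>B\<close>, then the remaining factors.\<close>
  note move = central_projection_commute[OF cp(1)] central_projection_left_commute[OF cp(1)]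
  note move' = central_projection_commute[OF cp(2)] central_projection_left_commute[OF cp(2)]
  note simps = a b star_mult star_star mult.assoc
    central_projection_simps[OF cp(1)] central_projection_simps[OF cp(2)]
    move[of B] move[of u] move[of "u\<^sup>\<star>"] move'[of u] move'[of "u\<^sup>\<star>"]
  have comm: "a * B = b * A"
    by (simp add: simps)
  \<comment> \<open>All terms in \<open>left\<close> normalize to
    \<open>A * B * u\<^sup>\<star> * r * u\<close>, those in \<open>right\<close> to
    \<open>A * B * u * r * u\<^sup>\<star>\<close>.\<close>
  have left: "a\<^sup>\<star> * r * b = A * b\<^sup>\<star> * r * b" "A * b\<^sup>\<star> * r * b = B * a\<^sup>\<star> * r * a"
    and right: "a * r * b\<^sup>\<star> = A * b * r * b\<^sup>\<star>" "A * b * r * b\<^sup>\<star> = B * a * r * a\<^sup>\<star>" for r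
    by (simp_all add: simps move[of r] move'[of r])
  have adj: "self_adjoint (a\<^sup>\<star> * b)" "self_adjoint (a * b\<^sup>\<star>)"
    unfolding self_adjoint_def by (simp_all add: simps)
  note glb = is_glb_conrad[OF \<open>a \<preceq> u\<close> \<open>b \<preceq> u\<close>]
  note lub = is_lub_conrad[OF \<open>a \<preceq> u\<close> \<open>b \<preceq> u\<close>]
  show ?thesis
    using comm left right adj glb lub
      partial_order.meet_eq_glb[OF partial_order_conrad glb]
      partial_order.join_eq_lub[OF partial_order_conrad lub]
    unfolding A_def B_def by (metis (no_types))
qed

end
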